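(* Let $D\ge2$, let $\sigma:\mathbb{R}^D\to\mathbb{R}^D$ be the softmax function, $\sigma_i(x)=e^{x_i}/\sum_{j=1}^De^{x_j}$, and let $\mathbf 1=(1,\dots,1)^\top\in\mathbb{R}^D$. For all $x,y\in\mathbb{R}^D$ such that $x,y\in\mathbf 1^\perp$ (i.e. $\sum_jx_j=\sum_jy_j=0$), $$\|\sigma(x)-\sigma(y)\|\le\frac{D}{(D-1)^2}\exp\!\Big(2\sqrt{\tfrac{D}{D-1}}\,\max(\|x\|,\|y\|)\Big)\,\|x-y\|.$$
   Context: $\|\cdot\|$ denotes the Euclidean norm on $\mathbb{R}^D$. *)

theory Defs
  imports "HOL-Analysis.Analysis"
begin

definition softmax :: "real ^ 'n \<Rightarrow> real ^ 'n"
  where "softmax x = (\<chi> i. exp (x $ i) / (\<Sum>j\<in>UNIV. exp (x $ j)))"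

lemma mem_orthogonal_comp_ones_iff:
  fixes x :: "real ^ 'n"
  shows "x \<in> orthogonal_comp {vec 1} \<longleftrightarrow> (\<Sum>j\<in>UNIV. x $ j) = 0"
  by (simp add: orthogonal_comp_def orthogonal_def inner_vec_def)

end

theory Submission
  imports Defs
begin

text \<open>The derivative of softmax at \<open>z\<close> sends \<open>h\<close> to the vector with entries
  \<open>p\<^sub>i (h\<^sub>i - m)\<close>, where \<open>p\<close> is the softmax of \<open>z\<close> and \<open>m\<close> the \<open>p\<close>-mean of \<open>h\<close>. Since the \<open>p\<close>-variance of
  \<open>h\<close> is at most its \<open>p\<close>-second moment, the operator norm of the derivative is at most \<open>max\<^sub>i p\<^sub>i\<close>.
  If \<open>z\<close> has mean zero, then \<open>\<Sum>\<^sub>j exp z\<^sub>j \<ge> D\<close>, so \<open>p\<^sub>i \<le> exp (norm z) / D\<close>. The mean value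
  inequality gives the Lipschitz constant \<open>exp (max (norm x) (norm y)) / D\<close>, which is already smaller than
  the constant claimed.\<close>

lemma sum_exp_pos: "(\<Sum>j\<in>UNIV. exp ((z :: real ^ 'n) $ j)) > 0"
  by (intro sum_pos) auto

lemma softmax_nonneg: "softmax z $ i \<ge> 0"
  using sum_exp_pos[of z] by (simp add: softmax_def)

lemma sum_softmax: "(\<Sum>i\<in>UNIV. softmax z $ i) = 1"
  using sum_exp_pos[of z] by (simp add: softmax_def flip: sum_divide_distrib)

text \<open>The quotient rule in each coordinate; dividing by the square of the normalising sum
  turns both exponentials back into softmax weights.\<close>

lemma has_derivative_softmax:
  "(softmax has_derivative
     (\<lambda>h. \<chi> i. softmax z $ i * (h $ i - (\<Sum>j\<in>UNIV. softmax z $ j * h $ j)))) (at z within S)"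
proof -
  have "((\<lambda>x. softmax x $ i) has_derivative
      (\<lambda>h. softmax z $ i * (h $ i - (\<Sum>j\<in>UNIV. softmax z $ j * h $ j)))) (at z within S)" for i
  proof -
    let ?s = "\<Sum>j\<in>UNIV. exp (z $ j)"
    have exp_nth: "((\<lambda>x. exp (x $ j)) has_derivative (\<lambda>h. exp (z $ j) * h $ j)) (at z within S)" for j
      using has_derivative_exp[OF bounded_linear_imp_has_derivative[OF bounded_linear_vec_nth[of j]]]
      by (simp add: mult.commute)
    have "((\<lambda>x. exp (x $ i) / (\<Sum>j\<in>UNIV. exp (x $ j))) has_derivative
      (\<lambda>h. (exp (z $ i) * h $ i * ?s - exp (z $ i) * (\<Sum>j\<in>UNIV. exp (z $ j) * h $ j)) / (?s * ?s)))
      (at z within S)"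
      by (intro has_derivative_divide' has_derivative_sum exp_nth)
        (use sum_exp_pos[of z] in simp)
    moreover have "(exp (z $ i) * h $ i * ?s - exp (z $ i) * (\<Sum>j\<in>UNIV. exp (z $ j) * h $ j)) / (?s * ?s)
        = softmax z $ i * (h $ i - (\<Sum>j\<in>UNIV. softmax z $ j * h $ j))" for h
      using sum_exp_pos[of z]
      by (simp add: softmax_def field_simps flip: sum_divide_distrib)
    ultimately show ?thesis
      by (simp add: softmax_def)
  qed
  then show ?thesis
    by (subst has_derivative_componentwise_within) (auto simp: Basis_vec_def inner_axis)
qed

text \<open>Expanding the square with weights of total mass 1 leaves the second moment minus the
  square of the mean.\<close>

lemma variance_le_second_moment:
  fixes p h :: "'a \<Rightarrow> real"
  assumes "sum p A = 1"
  shows "(\<Sum>i\<in>A. p i * (h i - (\<Sum>j\<in>A. p j * h j))\<^sup>2) \<le> (\<Sum>i\<in>A. p i * (h i)\<^sup>2)"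
proof -
  define m where "m = (\<Sum>j\<in>A. p j * h j)"
  have "(\<Sum>i\<in>A. p i * (h i - m)\<^sup>2) = (\<Sum>i\<in>A. p i * (h i)\<^sup>2 - 2 * m * (p i * h i) + m\<^sup>2 * p i)"
    by (intro sum.cong) (auto simp: power2_eq_square algebra_simps)
  also have "\<dots> = (\<Sum>i\<in>A. p i * (h i)\<^sup>2) - 2 * m * m + m\<^sup>2 * sum p A"
    unfolding m_def by (simp only: sum.distrib sum_subtractf sum_distrib_left)
  also have "\<dots> \<le> (\<Sum>i\<in>A. p i * (h i)\<^sup>2)"
    using assms by (simp add: power2_eq_square)
  finally show ?thesis
    by (simp add: m_def)
qed

text \<open>In the squared norm each weight occurs squared. One factor is bounded by
  \<open>P\<close>, the other serves as the weight of a variance; once the mean is dropped, that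
  factor is bounded by \<open>P\<close> too, giving \<open>P\<^sup>2\<close> times the squared norm
  of \<open>h\<close>.\<close>

lemma onorm_softmax_derivative_le:
  fixes z :: "real ^ 'n"
  assumes "\<And>i. softmax z $ i \<le> P"
  shows "onorm (\<lambda>h. \<chi> i. softmax z $ i * (h $ i - (\<Sum>j\<in>UNIV. softmax z $ j * h $ j))) \<le> P"
proof (rule onorm_bound)
  show P: "0 \<le> P"
    using softmax_nonneg assms by (rule order_trans)
  fix h :: "real ^ 'n"
  let ?p = "\<lambda>i. softmax z $ i"
  let ?m = "\<Sum>j\<in>UNIV. ?p j * h $ j"
  have "(norm (\<chi> i. ?p i * (h $ i - ?m)))\<^sup>2 = (\<Sum>i\<in>UNIV. ?p i * (?p i * (h $ i - ?m)\<^sup>2))"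
    by (simp add: norm_vec_def L2_set_def sum_nonneg softmax_nonneg power_mult_distrib
        power2_eq_square[of "softmax z $ i" for i] mult.assoc)
  also have "\<dots> \<le> (\<Sum>i\<in>UNIV. P * (?p i * (h $ i - ?m)\<^sup>2))"
    by (intro sum_mono mult_right_mono assms mult_nonneg_nonneg softmax_nonneg) auto
  also have "\<dots> \<le> P * (\<Sum>i\<in>UNIV. ?p i * (h $ i)\<^sup>2)"
    using variance_le_second_moment[OF sum_softmax, of z "\<lambda>i. h $ i"] P
    by (simp add: mult_left_mono flip: sum_distrib_left)
  also have "\<dots> \<le> P * (\<Sum>i\<in>UNIV. P * (h $ i)\<^sup>2)"
    by (intro sum_mono mult_left_mono mult_right_mono assms P) auto
  also have "\<dots> = (P * norm h)\<^sup>2"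
    by (simp add: norm_vec_def L2_set_def sum_nonneg power_mult_distrib power2_eq_square[of P]
        flip: sum_distrib_left)
  finally show "norm (\<chi> i. ?p i * (h $ i - ?m)) \<le> P * norm h"
    by (rule power2_le_imp_le) (simp add: P)
qed

text \<open>Summing \<open>1 + t \<le> exp t\<close> over the coordinates bounds the denominator
  below by the dimension, as the linear terms cancel.\<close>

lemma softmax_le_of_sum_eq_0:
  fixes z :: "real ^ 'n"
  assumes "(\<Sum>j\<in>UNIV. z $ j) = 0"
  shows "softmax z $ i \<le> exp (norm z) / real CARD('n)"
proof -
  have "real CARD('n) = (\<Sum>j\<in>UNIV. 1 + z $ j)"
    using assms by (simp add: sum.distrib)
  also have "\<dots> \<le> (\<Sum>j\<in>UNIV. exp (z $ j))"
    by (intro sum_mono exp_ge_add_one_self)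
  finally have "real CARD('n) \<le> (\<Sum>j\<in>UNIV. exp (z $ j))" .
  moreover have "z $ i \<le> norm z"
    using component_le_norm_cart[of z i] by simp
  ultimately show ?thesis
    by (simp add: softmax_def frac_le)
qed

theorem lemmaH6:
  fixes x y :: "real ^ 'n"
  assumes "CARD('n) \<ge> 2"
    and "x \<in> orthogonal_comp {vec 1}"
    and "y \<in> orthogonal_comp {vec 1}"
  shows "norm (softmax x - softmax y)
    \<le> real CARD('n) / (real CARD('n) - 1)\<^sup>2
        * exp (2 * sqrt (real CARD('n) / (real CARD('n) - 1)) * max (norm x) (norm y))
        * norm (x - y)"
proof -
  define D M where "D = real CARD('n)" and "M = max (norm x) (norm y)"
  have D: "D \<ge> 2" and M: "M \<ge> 0"
    using assms(1) by (auto simp: D_def M_def le_max_iff_disj)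
  \<comment> \<open>A convex set containing both points, hence the segment between them, on which
    mean zero and norm at most \<open>M\<close> make the derivative bound uniform.\<close>
  let ?S = "orthogonal_comp {vec 1 :: real ^ 'n} \<inter> cball 0 M"
  have "norm (softmax x - softmax y) \<le> exp M / D * norm (x - y)"
  proof (rule differentiable_bound[OF _ has_derivative_softmax])
    show "convex ?S"
      by (intro convex_Int subspace_imp_convex subspace_orthogonal_comp convex_cball)
    show "x \<in> ?S" "y \<in> ?S"
      using assms(2,3) by (auto simp: M_def)
    fix z assume z: "z \<in> ?S"
    have "softmax z $ i \<le> exp M / D" for i
    proof -
      have "softmax z $ i \<le> exp (norm z) / D"
        unfolding D_def using z mem_orthogonal_comp_ones_iff
        by (intro softmax_le_of_sum_eq_0) blast
      also have "\<dots> \<le> exp M / D"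
        using z D by (intro divide_right_mono) auto
      finally show ?thesis .
    qed
    then show "onorm (\<lambda>h. \<chi> i. softmax z $ i * (h $ i - (\<Sum>j\<in>UNIV. softmax z $ j * h $ j))) \<le> exp M / D"
      by (rule onorm_softmax_derivative_le)
  qed
  also have "exp M / D = 1 / D * exp M"
    by simp
  \<comment> \<open>Factor by factor: \<open>1 / D\<close> equals \<open>D / D\<^sup>2\<close>, and
    the coefficient of \<open>M\<close> in the exponent is at least 1.\<close>
  also have "\<dots> * norm (x - y) \<le> D / (D - 1)\<^sup>2 * exp (2 * sqrt (D / (D - 1)) * M) * norm (x - y)"
  proof (intro mult_right_mono mult_mono)
    have "(D - 1)\<^sup>2 \<le> D\<^sup>2"
      using D by (intro power_mono) auto
    then have "D / D\<^sup>2 \<le> D / (D - 1)\<^sup>2"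
      using D by (intro divide_left_mono) auto
    then show "1 / D \<le> D / (D - 1)\<^sup>2"
      using D by (simp add: power2_eq_square[of D])
    have "1 \<le> sqrt (D / (D - 1))"
      using D by simp
    then have "1 \<le> 2 * sqrt (D / (D - 1))"
      by linarith
    then have "1 * M \<le> 2 * sqrt (D / (D - 1)) * M"
      using M by (rule mult_right_mono)
    then show "exp M \<le> exp (2 * sqrt (D / (D - 1)) * M)"
      by simp
  qed (use D in auto)
  finally show ?thesis
    by (simp add: D_def M_def)
qed

end
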